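(* For sufficiently small constant $\epsilon>0$, $\mathrm{instopt}(I_n,\epsilon,1/10)=\Omega(n^{1/3})$ samples in the sampling model.
   Context: $I_n$ is the graph consisting of $n$ vertex-disjoint triangles. Sampling model: a (nonadaptive) sampling algorithm chooses, independently of the input, a distribution over sets $S$ of vertex pairs, receives $E(G')\cap S$ for its input graph $G'$, and pays $\mathbb{E}|E(G')\cap S|$ samples. An algorithm solves $G$ with $S$ samples and $(\epsilon,\delta)$ error if, for every graph $G'$ isomorphic to some subgraph of $G$, it returns a value in $T(G')\pm\epsilon T(G)$ with probability at least $1-\delta$ using at most $S$ samples, where $T(H)$ is the number of triangles of $H$; $\mathrm{instopt}(G,\epsilon,\delta)$ is the least such $S$ over all sampling algorithms. *)

theory Defs
  imports "HOL-Probability.Probability" "HOL-Library.Landau_Symbols"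
begin

text \<open>A simple graph is a pair of a vertex set and a set of edges, the edges being two-element
  sets of vertices.\<close>

type_synonym 'a graph = "'a set \<times> 'a set set"

abbreviation verts :: "'a graph \<Rightarrow> 'a set" where
  "verts G \<equiv> fst G"

abbreviation edges :: "'a graph \<Rightarrow> 'a set set" where
  "edges G \<equiv> snd G"

definition vpairs :: "'a set \<Rightarrow> 'a set set" where
  "vpairs V = {e. e \<subseteq> V \<and> card e = 2}"

definition is_graph :: "'a graph \<Rightarrow> bool" where
  "is_graph G \<longleftrightarrow> finite (verts G) \<and> edges G \<subseteq> vpairs (verts G)"

definition is_subgraph :: "'a graph \<Rightarrow> 'a graph \<Rightarrow> bool" where
  "is_subgraph H G \<longleftrightarrow> is_graph H \<and> verts H \<subseteq> verts G \<and> edges H \<subseteq> edges G"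

definition graph_iso :: "'a graph \<Rightarrow> 'b graph \<Rightarrow> bool" where
  "graph_iso G H \<longleftrightarrow>
     (\<exists>f. bij_betw f (verts G) (verts H) \<and> edges H = (\<lambda>e. f ` e) ` edges G)"

definition triangles :: "'a graph \<Rightarrow> nat" where
  "triangles G = card {t. t \<subseteq> verts G \<and> card t = 3 \<and> vpairs t \<subseteq> edges G}"

text \<open>The inputs for \<open>G\<close>: since the sampled vertex pairs are chosen independently of the input,
  all inputs live on a common set of labels, which is the vertex set of \<open>G\<close>.\<close>

definition inputs :: "'a graph \<Rightarrow> 'a graph set" where
  "inputs G = {G'. is_graph G' \<and> verts G' \<subseteq> verts G \<and> (\<exists>H. is_subgraph H G \<and> graph_iso G' H)}"

text \<open>A nonadaptive sampling algorithm on the vertex set \<open>V\<close> consists of a distribution \<open>D\<close> of the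
  set \<open>S\<close> of queried pairs and a randomized estimator: \<open>est S X\<close> is the distribution of the value
  returned when \<open>S\<close> was queried and \<open>X\<close> is the set of edges received.\<close>

definition sampling_algorithm ::
  "'a set \<Rightarrow> 'a set set pmf \<Rightarrow> ('a set set \<Rightarrow> 'a set set \<Rightarrow> real measure) \<Rightarrow> bool" where
  "sampling_algorithm V D est \<longleftrightarrow>
     set_pmf D \<subseteq> Pow (vpairs V) \<and> (\<forall>S X. est S X \<in> space (prob_algebra borel))"

definition sample_cost :: "'a set set pmf \<Rightarrow> 'a graph \<Rightarrow> real" where
  "sample_cost D G' = measure_pmf.expectation D (\<lambda>S. real (card (edges G' \<inter> S)))"

definition return_prob ::
  "'a set set pmf \<Rightarrow> ('a set set \<Rightarrow> 'a set set \<Rightarrow> real measure) \<Rightarrow> 'a graph \<Rightarrow> real set \<Rightarrow> real" where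
  "return_prob D est G' A = measure_pmf.expectation D (\<lambda>S. measure (est S (edges G' \<inter> S)) A)"

definition solves ::
  "'a set set pmf \<Rightarrow> ('a set set \<Rightarrow> 'a set set \<Rightarrow> real measure) \<Rightarrow>
   'a graph \<Rightarrow> real \<Rightarrow> real \<Rightarrow> real \<Rightarrow> bool" where
  "solves D est G s \<epsilon> \<delta> \<longleftrightarrow>
     (\<forall>G' \<in> inputs G.
        return_prob D est G'
          {real (triangles G') - \<epsilon> * real (triangles G) ..
           real (triangles G') + \<epsilon> * real (triangles G)} \<ge> 1 - \<delta> \<and>
        sample_cost D G' \<le> s)"

definition instopt :: "'a graph \<Rightarrow> real \<Rightarrow> real \<Rightarrow> real" where
  "instopt G \<epsilon> \<delta> =
     Inf {s. \<exists>D est. sampling_algorithm (verts G) D est \<and> solves D est G s \<epsilon> \<delta>}"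

text \<open>The infimum is over a nonempty set that is bounded below: querying all pairs determines the
  edge set of the input.\<close>

lemma instopt_set_nonempty:
  assumes G: "is_graph G" and "0 \<le> \<epsilon>" "0 \<le> \<delta>"
  shows "{s. \<exists>D est. sampling_algorithm (verts G) D est \<and> solves D est G s \<epsilon> \<delta>} \<noteq> {}"
proof -
  define D where "D = return_pmf (vpairs (verts G))"
  define est where
    "est = (\<lambda>(S::'a set set) X. return borel (real (triangles (verts G, X))))"
  define s where "s = real (card (vpairs (verts G)))"
  have fin: "finite (vpairs (verts G))"
    using G by (auto simp: vpairs_def is_graph_def intro: finite_subset[of _ "Pow (verts G)"])
  have "sampling_algorithm (verts G) D est"
    by (auto simp: sampling_algorithm_def D_def est_def space_prob_algebra prob_space_return)
  moreover have "solves D est G s \<epsilon> \<delta>"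
    unfolding solves_def
  proof (intro ballI)
    fix G' assume "G' \<in> inputs G"
    then have E: "edges G' \<subseteq> vpairs (verts G')" and V: "verts G' \<subseteq> verts G"
      by (auto simp: inputs_def is_graph_def)
    have E': "edges G' \<inter> vpairs (verts G) = edges G'"
      using E V by (auto simp: vpairs_def)
    have sub: "t \<subseteq> verts G'" if "card t = 3" "vpairs t \<subseteq> edges G'" for t
    proof
      fix x assume x: "x \<in> t"
      have "card (t - {x}) = 2" using that(1) x by simp
      then obtain y where "y \<in> t" "y \<noteq> x"
        by (metis Diff_iff card.empty equals0I insertI1 zero_neq_numeral)
      then have "{x, y} \<in> vpairs t" using x by (auto simp: vpairs_def)
      then have "{x, y} \<in> vpairs (verts G')" using that(2) E by blast
      then show "x \<in> verts G'" by (simp add: vpairs_def)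
    qed
    have T: "triangles (verts G, edges G') = triangles G'"
      unfolding triangles_def using sub V by (auto intro!: arg_cong[where f = card])
    show "1 - \<delta> \<le> return_prob D est G'
          {real (triangles G') - \<epsilon> * real (triangles G) ..
           real (triangles G') + \<epsilon> * real (triangles G)} \<and> sample_cost D G' \<le> s"
      using assms fin
      by (auto simp: return_prob_def sample_cost_def D_def est_def s_def E' T measure_return
          intro!: card_mono E'[THEN equalityD2, THEN subset_trans])
  qed
  ultimately show ?thesis by blast
qed

lemma instopt_set_bdd_below:
  "bdd_below {s. \<exists>D est. sampling_algorithm (verts G) D est \<and> solves D est G s \<epsilon> \<delta>}"
  if G: "is_graph G"
proof (rule bdd_belowI)
  fix s assume "s \<in> {s. \<exists>D est. sampling_algorithm (verts G) D est \<and> solves D est G s \<epsilon> \<delta>}"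
  then obtain D est where "solves D est G s \<epsilon> \<delta>" by blast
  moreover have "G \<in> inputs G"
  proof -
    have "is_subgraph G G" using G by (simp add: is_subgraph_def)
    moreover have "graph_iso G G"
      unfolding graph_iso_def by (intro exI[of _ id]) simp
    ultimately show ?thesis using G unfolding inputs_def by blast
  qed
  ultimately have "sample_cost D G \<le> s" by (auto simp: solves_def)
  moreover have "0 \<le> sample_cost D G" by (simp add: sample_cost_def)
  ultimately show "0 \<le> s" by linarith
qed

text \<open>Vertex \<open>(i, a)\<close> is the \<open>a\<close>-th corner of the \<open>i\<close>-th triangle.\<close>

definition disjoint_triangles :: "nat \<Rightarrow> (nat \<times> nat) graph" where
  "disjoint_triangles n =
     ({..<n} \<times> {..<3}, {{(i, a), (i, b)} | i a b. i < n \<and> a < 3 \<and> b < 3 \<and> a \<noteq> b})"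

lemma is_graph_disjoint_triangles: "is_graph (disjoint_triangles n)"
  by (auto simp: is_graph_def disjoint_triangles_def vpairs_def)

end

theory Submission
  imports Defs
begin

text \<open>Keep in every triangle, independently, a uniformly random set of sides of even size, or one of
  odd size, and relabel the vertices by a random permutation. Any two sides of a triangle are
  distributed alike in both cases, so the two inputs are told apart only if some relabelled triangle
  lies entirely in the query set \<open>S\<close>; yet the first has no triangle while the second has \<open>n/4\<close> of
  them on average. A query set with \<open>r\<close> arcs has at most \<open>r\<^bsup>3/2\<^esup>\<close> ordered triangles, so it contains a
  given relabelled triangle with probability at most \<open>r\<^bsup>3/2\<^esup>/n\<^sup>3\<close>, and some relabelled triangle with
  probability at most \<open>min 1 (r\<^bsup>3/2\<^esup>/n\<^sup>2) \<le> r/n\<^bsup>4/3\<^esup>\<close>. Being linear in \<open>r\<close>, this bound survives the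
  expectation over \<open>S\<close>, and the expected cost on a randomly relabelled \<open>I\<^sub>n\<close> is about \<open>r/(3n)\<close>.\<close>

section \<open>Permutations with prescribed values\<close>

text \<open>Extend the list one entry at a time: composing the permutation for the prefix with the
  transposition of \<open>p x\<close> and \<open>y\<close> corrects the new value and moves no
  earlier one, since those differ from both.\<close>

lemma exists_permutes_map_eq:
  assumes "distinct xs" "distinct ys" "length xs = length ys" "set xs \<subseteq> V" "set ys \<subseteq> V"
  shows "\<exists>p. p permutes V \<and> map p xs = ys"
  using assms
proof (induction xs arbitrary: ys rule: rev_induct)
  case Nil
  then show ?case by (intro exI[of _ id]) (use permutes_id in \<open>auto simp: id_def\<close>)
next
  case (snoc x xs)
  then obtain ys' y where ys: "ys = ys' @ [y]" and l: "length ys' = length xs"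
    by (metis length_append_singleton length_Suc_conv_rev)
  obtain p where p: "p permutes V" "map p xs = ys'"
    using snoc.IH[of ys'] snoc.prems l ys by auto
  have px: "p x \<in> V" using p(1) snoc.prems(4) by (simp add: permutes_in_image)
  let ?q = "Transposition.transpose (p x) y \<circ> p"
  have q: "?q permutes V"
    using p(1) px snoc.prems(5) ys by (intro permutes_compose permutes_swap_id) auto
  have "?q z = p z" if "z \<in> set xs" for z
  proof -
    have "p z \<noteq> p x" using that snoc.prems(1) permutes_inj[OF p(1)] by (auto dest: injD)
    moreover have "p z \<in> set ys'" using p(2) that by auto
    then have "p z \<noteq> y" using snoc.prems(2) ys by auto
    ultimately show ?thesis by (simp add: transpose_apply_other)
  qed
  then have "map ?q (xs @ [x]) = ys" using p(2) ys by auto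
  with q show ?case by blast
qed

text \<open>A left coset of the pointwise stabiliser of \<open>set xs\<close>, which consists of the
  permutations of \<open>V - set xs\<close>.\<close>

lemma card_permutes_map_eq:
  assumes "finite V" "distinct xs" "distinct ys" "length xs = length ys" "set xs \<subseteq> V" "set ys \<subseteq> V"
  shows "card {p. p permutes V \<and> map p xs = ys} = fact (card V - length xs)"
proof -
  obtain q where q: "q permutes V" "map q xs = ys"
    using exists_permutes_map_eq[OF assms(2-6)] by blast
  have stab: "{p. p permutes V \<and> map p xs = xs} = {p. p permutes (V - set xs)}"
  proof (intro equalityI subsetI; clarify)
    fix p assume p: "p permutes V" "map p xs = xs"
    have "p x = x" if "x \<in> set xs" for x using p(2) that using map_eq_conv[of p xs id] by simp
    then show "p permutes (V - set xs)" using p(1) by (intro permutes_superset[OF p(1)]) blast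
  next
    fix p assume p: "p permutes (V - set xs)"
    then have "map p xs = xs" by (intro map_idI) (simp add: permutes_not_in)
    then show "p permutes V \<and> map p xs = xs" using permutes_subset[OF p, of V] by simp
  qed
  have "bij_betw (\<lambda>p. q \<circ> p) {p. p permutes V \<and> map p xs = xs} {p. p permutes V \<and> map p xs = ys}"
  proof (rule bij_betw_byWitness[where f' = "\<lambda>p. inv q \<circ> p"])
    have "inv q \<circ> q = id" "q \<circ> inv q = id"
      using q(1) permutes_inv_o by blast+
    then show "\<forall>p\<in>{p. p permutes V \<and> map p xs = xs}. inv q \<circ> (q \<circ> p) = p"
      "\<forall>p\<in>{p. p permutes V \<and> map p xs = ys}. q \<circ> (inv q \<circ> p) = p"
      by (auto simp: fun_eq_iff)
    show "(\<lambda>p. q \<circ> p) ` {p. p permutes V \<and> map p xs = xs} \<subseteq> {p. p permutes V \<and> map p xs = ys}"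
      using q by (intro image_subsetI CollectI conjI)
        (simp_all add: permutes_compose flip: list.map_comp)
    have "map (inv q) ys = xs"
      using q permutes_inv_o(2)[OF q(1)] by (metis list.map_id map_map)
    then show "(\<lambda>p. inv q \<circ> p) ` {p. p permutes V \<and> map p xs = ys} \<subseteq> {p. p permutes V \<and> map p xs = xs}"
      using q by (intro image_subsetI CollectI conjI)
        (simp_all add: permutes_compose permutes_inv flip: list.map_comp)
  qed
  then have "card {p. p permutes V \<and> map p xs = ys} = card {p. p permutes (V - set xs)}"
    using stab bij_betw_same_card by force
  also have "\<dots> = fact (card V - length xs)"
    using assms by (simp add: card_permutations card_Diff_subset distinct_card)
  finally show ?thesis .
qed

section \<open>Triangle count of a query set\<close>

text \<open>Each pair occurs in both directions, so a single arc or ordered triangle prescribes the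
  exact images of listed corners under a relabelling.\<close>

definition arcs :: "'a set set \<Rightarrow> ('a \<times> 'a) set" where
  "arcs S = {(x, y). x \<noteq> y \<and> {x, y} \<in> S}"

definition ordered_triangles :: "('a \<times> 'a) set \<Rightarrow> ('a \<times> 'a \<times> 'a) set" where
  "ordered_triangles R = {(x, y, z). (x, y) \<in> R \<and> (y, z) \<in> R \<and> (x, z) \<in> R}"

text \<open>A pair of triangles on a common arc \<open>(x, y)\<close> with apexes \<open>z\<close> and \<open>w\<close> is determined by the
  arcs \<open>(x, y)\<close>, \<open>(x, z)\<close>, \<open>(y, w)\<close>; Cauchy--Schwarz over the common arc does the rest.\<close>

lemma card_ordered_triangles_squared_le:
  assumes "finite R"
  shows "(card (ordered_triangles R))\<^sup>2 \<le> card R ^ 3"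
proof -
  define C where "C = (\<lambda>(x, y). {z. (y, z) \<in> R \<and> (x, z) \<in> R})"
  have finC: "finite (C a)" for a
    by (rule finite_subset[of _ "snd ` R"]) (use assms in \<open>force simp: C_def\<close>)+
  have "ordered_triangles R = (\<lambda>((x, y), z). (x, y, z)) ` (SIGMA a:R. C a)"
    by (force simp: ordered_triangles_def C_def image_iff)
  moreover have "inj_on (\<lambda>((x, y), z). (x, y, z)) (SIGMA a:R. C a)"
    by (auto simp: inj_on_def)
  ultimately have T: "card (ordered_triangles R) = (\<Sum>a\<in>R. card (C a))"
    using assms finC by (simp add: card_image)
  have "real ((\<Sum>a\<in>R. card (C a))\<^sup>2) = (\<Sum>a\<in>R. 1 * real (card (C a)))\<^sup>2" by simp
  also have "\<dots> \<le> (\<Sum>a\<in>R. 1\<^sup>2) * (\<Sum>a\<in>R. (real (card (C a)))\<^sup>2)"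
    by (rule Cauchy_Schwarz_ineq_sum)
  also have "(\<Sum>a\<in>R. (real (card (C a)))\<^sup>2) = real (card (SIGMA a:R. C a \<times> C a))"
    using assms finC by (simp add: power2_eq_square)
  also have "card (SIGMA a:R. C a \<times> C a) \<le> card (R \<times> R)"
    by (rule card_inj_on_le[where f = "\<lambda>((x, y), z, w). ((x, z), (y, w))"])
      (use assms in \<open>auto simp: inj_on_def C_def\<close>)
  finally have "real ((\<Sum>a\<in>R. card (C a))\<^sup>2) \<le> real (card R) * real (card (R \<times> R))"
    by (simp add: mult_left_mono)
  also have "\<dots> = real (card R ^ 3)" by (simp add: card_cartesian_product power3_eq_cube)
  finally show ?thesis unfolding T by (simp only: of_nat_le_iff)
qed

section \<open>Patterns of kept sides as inputs\<close>

text \<open>\<open>tri_pair i k\<close> is the side opposite to corner \<open>k\<close>; a pattern \<open>f\<close> keeps the sides \<open>f i\<close> of the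
  \<open>i\<close>-th triangle, and \<open>p\<close> relabels the vertices.\<close>

definition tri_pair :: "nat \<Rightarrow> nat \<Rightarrow> (nat \<times> nat) set" where
  "tri_pair i k = {i} \<times> ({..<3} - {k})"

definition pattern_edges ::
  "nat \<Rightarrow> (nat \<times> nat \<Rightarrow> nat \<times> nat) \<Rightarrow> (nat \<Rightarrow> nat set) \<Rightarrow> (nat \<times> nat) set set" where
  "pattern_edges n p f = {p ` tri_pair i k | i k. i < n \<and> k \<in> f i}"

definition full_count :: "nat \<Rightarrow> (nat \<Rightarrow> nat set) \<Rightarrow> nat" where
  "full_count n f = card {i. i < n \<and> f i = {..<3}}"

lemma lessThan_3: "{..<3::nat} = {0, 1, 2}" by auto

lemma tri_pair_eq_iff:
  assumes "k < 3" "l < 3"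
  shows "tri_pair i k = tri_pair j l \<longleftrightarrow> i = j \<and> k = l"
proof
  assume *: "tri_pair i k = tri_pair j l"
  obtain a :: nat where "a < 3" "a \<noteq> k"
    by (metis one_less_numeral_iff semiring_norm(77) zero_less_numeral zero_neq_one)
  then have "(i, a) \<in> tri_pair i k" by (simp add: tri_pair_def)
  then have "(i, a) \<in> tri_pair j l" using * by (simp only:)
  then have "i = j" by (simp add: tri_pair_def)
  moreover have "(i, k) \<notin> tri_pair i k" by (simp add: tri_pair_def)
  then have "k = l" using * assms \<open>i = j\<close> by (auto simp: tri_pair_def)
  ultimately show "i = j \<and> k = l" ..
qed simp

lemma tri_pair_in_vpairs:
  assumes "i < n" "k < 3"
  shows "tri_pair i k \<in> vpairs ({..<n} \<times> {..<3})"
  using assms by (auto simp: tri_pair_def vpairs_def card_cartesian_product)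

text \<open>A two-element set of corners is the complement of a single corner.\<close>

lemma vpairs_triangle: "vpairs ({i} \<times> {..<3::nat}) = tri_pair i ` {..<3}"
proof (intro equalityI subsetI)
  fix e :: "(nat \<times> nat) set" assume "e \<in> vpairs ({i} \<times> {..<3})"
  then have e: "e \<subseteq> {i} \<times> {..<3}" "card e = 2" by (auto simp: vpairs_def)
  have "card ({i} \<times> {..<3::nat} - e) = 1"
    using e by (subst card_Diff_subset) (auto simp: card_cartesian_product intro: finite_subset)
  then obtain x where x: "{i} \<times> {..<3} - e = {x}" by (auto simp: card_1_singleton_iff)
  then obtain k where "x = (i, k)" "k < 3"
    by (metis DiffD1 insertI1 lessThan_iff mem_Sigma_iff singletonD surj_pair)
  moreover have "e = {i} \<times> {..<3} - {x}" using x e(1) by blast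
  ultimately show "e \<in> tri_pair i ` {..<3}" by (auto simp: tri_pair_def)
qed (auto simp: tri_pair_def vpairs_def card_cartesian_product)

lemma edges_disjoint_triangles: "edges (disjoint_triangles n) = pattern_edges n id (\<lambda>_. {..<3})"
proof -
  have *: "{{(i, a), (i, b)} | a b. a < (3::nat) \<and> b < 3 \<and> a \<noteq> b} = vpairs ({i} \<times> {..<3})" for i :: nat
    by (auto simp: vpairs_def card_2_iff)
  have "edges (disjoint_triangles n) = (\<Union>i<n. vpairs ({i} \<times> {..<3}))"
    unfolding disjoint_triangles_def by (simp flip: *) blast
  then show ?thesis by (auto simp: vpairs_triangle pattern_edges_def)
qed

lemma vpairs_image:
  assumes "inj p"
  shows "vpairs (p ` t) = image p ` vpairs t"
  unfolding vpairs_def using assms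
  by (auto simp: subset_image_iff card_image inj_on_subset)

lemma pattern_edges_image: "pattern_edges n p f = image p ` pattern_edges n id f"
  by (auto simp: pattern_edges_def)

lemma triangles_relabel:
  assumes "p permutes V"
  shows "triangles (V, image p ` E) = triangles (V, E)"
proof -
  have inj: "inj p" and im: "p ` V = V" using assms by (auto simp: permutes_inj permutes_image)
  have "{t. t \<subseteq> V \<and> card t = 3 \<and> vpairs t \<subseteq> image p ` E} =
        image p ` {t. t \<subseteq> V \<and> card t = 3 \<and> vpairs t \<subseteq> E}"
  proof (intro equalityI subsetI)
    fix t assume "t \<in> {t. t \<subseteq> V \<and> card t = 3 \<and> vpairs t \<subseteq> image p ` E}"
    moreover from this obtain u where "u \<subseteq> V" "t = p ` u" using im 
      by (metis (no_types, lifting) mem_Collect_eq subset_imageE)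
    ultimately show "t \<in> image p ` {t. t \<subseteq> V \<and> card t = 3 \<and> vpairs t \<subseteq> E}"
      using inj by (auto simp: vpairs_image card_image inj_on_subset inj_image_eq_iff inj_image_subset_iff
          intro!: imageI)
  next
    fix t assume "t \<in> image p ` {t. t \<subseteq> V \<and> card t = 3 \<and> vpairs t \<subseteq> E}"
    then show "t \<in> {t. t \<subseteq> V \<and> card t = 3 \<and> vpairs t \<subseteq> image p ` E}"
      using inj im by (auto simp: vpairs_image card_image inj_on_subset) blast
  qed
  then show ?thesis using inj
    by (simp add: triangles_def card_image inj_on_def inj_image_eq_iff)
qed

text \<open>Every edge joins corners of one original triangle, so a triangle of the pattern graph
  must be one of these, and by injectivity of \<open>tri_pair\<close> all its sides are kept.
  Relabelling preserves the count, which reduces the proof to \<open>id\<close>.\<close>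

lemma triangles_pattern:
  assumes p: "p permutes ({..<n} \<times> {..<3})" and f: "\<And>i. i < n \<Longrightarrow> f i \<subseteq> {..<3}"
  shows "triangles ({..<n} \<times> {..<3}, pattern_edges n p f) = full_count n f"
proof -
  have "{t. t \<subseteq> {..<n} \<times> {..<3} \<and> card t = 3 \<and> vpairs t \<subseteq> pattern_edges n id f} =
        (\<lambda>i. {i} \<times> {..<3::nat}) ` {i. i < n \<and> f i = {..<3}}"
  proof (intro equalityI subsetI)
    fix t assume "t \<in> {t. t \<subseteq> {..<n} \<times> {..<3} \<and> card t = 3 \<and> vpairs t \<subseteq> pattern_edges n id f}"
    then have t: "t \<subseteq> {..<n} \<times> {..<3}" "card t = 3" "vpairs t \<subseteq> pattern_edges n id f" by auto
    then obtain x where x: "x \<in> t" by (metis card.empty equals0I zero_neq_numeral)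
    have "fst y = fst x" if y: "y \<in> t" for y
    proof (cases "y = x")
      case False
      then have "{x, y} \<in> vpairs t" using x y by (auto simp: vpairs_def)
      then obtain i k where "{x, y} = tri_pair i k" using t(3) by (auto simp: pattern_edges_def)
      then have "x \<in> tri_pair i k" "y \<in> tri_pair i k" by auto
      then show ?thesis by (auto simp: tri_pair_def)
    qed simp
    then have "t \<subseteq> {fst x} \<times> {..<3}" using t(1) by fastforce
    then have teq: "t = {fst x} \<times> {..<3}"
      using t(2) by (intro card_subset_eq) (auto simp: card_cartesian_product)
    have xn: "fst x < n" using x t(1) by auto
    have "k \<in> f (fst x)" if "k < 3" for k
    proof -
      have "tri_pair (fst x) k \<in> pattern_edges n id f"
        using t(3) that unfolding teq vpairs_triangle by blast
      then obtain i l where "tri_pair (fst x) k = tri_pair i l" "i < n" "l \<in> f i"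
        by (auto simp: pattern_edges_def)
      then show ?thesis using f[of i] that tri_pair_eq_iff[of k l "fst x" i] by auto
    qed
    then have "f (fst x) = {..<3}" using f[OF xn] by auto
    then show "t \<in> (\<lambda>i. {i} \<times> {..<3}) ` {i. i < n \<and> f i = {..<3}}" using teq xn by blast
  next
    fix t assume "t \<in> (\<lambda>i. {i} \<times> {..<3::nat}) ` {i. i < n \<and> f i = {..<3}}"
    then obtain i where i: "t = {i} \<times> {..<3}" "i < n" "f i = {..<3}" by blast
    have "vpairs t \<subseteq> pattern_edges n id f"
      unfolding i(1) vpairs_triangle pattern_edges_def using i(2,3) by fastforce
    then show "t \<in> {t. t \<subseteq> {..<n} \<times> {..<3} \<and> card t = 3 \<and> vpairs t \<subseteq> pattern_edges n id f}"
      using i(1,2) by (simp add: card_cartesian_product Sigma_mono)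
  qed
  moreover have "inj_on (\<lambda>i. {i} \<times> {..<3::nat}) {i. i < n \<and> f i = {..<3}}"
  proof (rule inj_onI)
    fix i j assume *: "{i} \<times> {..<3::nat} = {j} \<times> {..<3}"
    have "(i, 0::nat) \<in> {i} \<times> {..<3}" by simp
    then have "(i, 0::nat) \<in> {j} \<times> {..<3}" by (simp only: *)
    then show "i = j" by simp
  qed
  ultimately have "triangles ({..<n} \<times> {..<3}, pattern_edges n id f) = full_count n f"
    by (simp add: triangles_def full_count_def card_image)
  then show ?thesis
    using triangles_relabel[OF p] pattern_edges_image[of n p f] by simp
qed

text \<open>Isolated vertices are retained, so \<open>inv p\<close> is an isomorphism onto a
  subgraph of \<open>disjoint_triangles n\<close> with the full vertex set.\<close>

lemma pattern_in_inputs: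
  assumes p: "p permutes ({..<n} \<times> {..<3})" and f: "\<And>i. i < n \<Longrightarrow> f i \<subseteq> {..<3}"
  shows "({..<n} \<times> {..<3}, pattern_edges n p f) \<in> inputs (disjoint_triangles n)"
proof -
  let ?V = "{..<n} \<times> {..<3::nat}"
  have sub: "pattern_edges n id f \<subseteq> pattern_edges n id (\<lambda>_. {..<3})"
    using f by (fastforce simp: pattern_edges_def)
  have vp: "pattern_edges n id f \<subseteq> vpairs ?V"
    using f tri_pair_in_vpairs by (fastforce simp: pattern_edges_def)
  have "pattern_edges n p f \<subseteq> image p ` vpairs ?V"
    unfolding pattern_edges_image[of n p f] using vp by blast
  also have "\<dots> = vpairs ?V"
    using p by (simp flip: vpairs_image add: permutes_inj permutes_image)
  finally have "is_graph (?V, pattern_edges n p f)" by (simp add: is_graph_def)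
  moreover have "is_subgraph (?V, pattern_edges n id f) (disjoint_triangles n)"
    using sub vp by (simp add: is_subgraph_def is_graph_def edges_disjoint_triangles)
      (simp add: disjoint_triangles_def)
  moreover have "graph_iso (?V, pattern_edges n p f) (?V, pattern_edges n id f)"
    unfolding graph_iso_def
  proof (intro exI[of _ "inv p"] conjI)
    show "bij_betw (inv p) (verts (?V, pattern_edges n p f)) (verts (?V, pattern_edges n id f))"
      using permutes_inv[OF p] by (simp add: permutes_imp_bij)
    show "edges (?V, pattern_edges n id f) = (\<lambda>e. inv p ` e) ` edges (?V, pattern_edges n p f)"
      using permutes_inj[OF p] by (simp add: pattern_edges_image[of n p f] image_image image_comp)
  qed
  ultimately show ?thesis by (auto simp: inputs_def disjoint_triangles_def)
qed

lemma triangles_disjoint_triangles: "triangles (disjoint_triangles n) = n"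
proof -
  have "disjoint_triangles n = ({..<n} \<times> {..<3}, pattern_edges n id (\<lambda>_. {..<3}))"
    by (simp add: prod_eq_iff edges_disjoint_triangles) (simp add: disjoint_triangles_def)
  then show ?thesis
    using triangles_pattern[of id n "\<lambda>_. {..<3}"] by (simp add: permutes_id full_count_def)
qed

section \<open>Exchanging the parities\<close>

text \<open>Symmetric difference with \<open>{k}\<close>.\<close>

definition toggle :: "'a \<Rightarrow> 'a set \<Rightarrow> 'a set" where
  "toggle k A = (if k \<in> A then A - {k} else insert k A)"

lemma toggle_toggle [simp]: "toggle k (toggle k A) = A"
  by (auto simp: toggle_def)

lemma even_card_toggle: "finite A \<Longrightarrow> even (card (toggle k A)) \<longleftrightarrow> odd (card A)"
  by (auto simp: toggle_def card_Diff_singleton card_gt_0_iff even_diff_nat)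

text \<open>\<open>True\<close> stands for even parity. Extensional functions keep the set finite,
  so uniform averages over patterns become finite sums.\<close>

definition patterns :: "nat \<Rightarrow> bool \<Rightarrow> (nat \<Rightarrow> nat set) set" where
  "patterns n b = (\<Pi>\<^sub>E i\<in>{..<n}. {A. A \<subseteq> {..<3} \<and> (even (card A) \<longleftrightarrow> b)})"

text \<open>All three sides must be queried, whether or not a pattern keeps them; the event depends
  on \<open>S\<close> and \<open>p\<close> alone.\<close>

definition seen :: "nat \<Rightarrow> (nat \<times> nat) set set \<Rightarrow> (nat \<times> nat \<Rightarrow> nat \<times> nat) \<Rightarrow> bool" where
  "seen n S p \<longleftrightarrow> (\<exists>i<n. \<forall>k<3. p ` tri_pair i k \<in> S)"

lemma patterns_subset: "f \<in> patterns n b \<Longrightarrow> i < n \<Longrightarrow> f i \<subseteq> {..<3}"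
  by (auto simp: patterns_def PiE_iff)

lemma finite_patterns: "finite (patterns n b)"
  by (auto simp: patterns_def intro!: finite_PiE intro: finite_subset[of _ "Pow {..<3}"])

text \<open>Toggling an unqueried side of every triangle exchanges the two parities and does not
  change the answer to the query.\<close>

lemma sum_patterns_eq_if_not_seen:
  assumes "\<not> seen n S p"
  shows "(\<Sum>f\<in>patterns n True. h (pattern_edges n p f \<inter> S)) =
         (\<Sum>f\<in>patterns n False. h (pattern_edges n p f \<inter> S))"
proof -
  obtain m where m: "\<And>i. i < n \<Longrightarrow> m i < 3 \<and> p ` tri_pair i (m i) \<notin> S"
    using assms unfolding seen_def by metis
  \<comment> \<open>The restriction to \<open>{..<n}\<close> keeps the toggled pattern extensional,
    hence in \<open>patterns\<close>.\<close>
  define tog where "tog f = (\<lambda>i\<in>{..<n}. toggle (m i) (f i))" for f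
  have tog_tog: "tog (tog f) = f" if "f \<in> patterns n b" for f b
    using that by (auto simp: tog_def patterns_def PiE_def extensional_def fun_eq_iff)
  have tog_in: "tog f \<in> patterns n (\<not> b)" if f: "f \<in> patterns n b" for f b
  proof -
    have "toggle (m i) (f i) \<subseteq> {..<3} \<and> (even (card (toggle (m i) (f i))) \<longleftrightarrow> \<not> b)" if "i < n" for i
    proof
      have s: "f i \<subseteq> {..<3}" by (rule patterns_subset[OF f that])
      then show "toggle (m i) (f i) \<subseteq> {..<3}" using m[OF that] by (auto simp: toggle_def)
      have "even (card (f i)) \<longleftrightarrow> b" using f that by (auto simp: patterns_def PiE_iff)
      then show "even (card (toggle (m i) (f i))) \<longleftrightarrow> \<not> b"
        using even_card_toggle[OF finite_subset[OF s finite_lessThan]] by simp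
    qed
    then show ?thesis by (simp add: patterns_def tog_def)
  qed
  have obs: "pattern_edges n p (tog f) \<inter> S = pattern_edges n p f \<inter> S" for f
  proof -
    have "k \<in> tog f i \<longleftrightarrow> k \<in> f i" if "i < n" "p ` tri_pair i k \<in> S" for i k
    proof -
      have "k \<noteq> m i" using m that by blast
      then show ?thesis using that(1) by (simp add: tog_def toggle_def)
    qed
    then show ?thesis by (auto simp: pattern_edges_def)
  qed
  show ?thesis
    by (rule sum.reindex_bij_witness[where i = tog and j = tog])
      (use tog_tog tog_in[of _ True] tog_in[of _ False] obs in auto)
qed

text \<open>The empty query set sees no triangle, so the parity exchange applies; the constant
  function 1 turns its sums into cardinalities.\<close>

lemma card_patterns_eq: "card (patterns n True) = card (patterns n False)"
proof -
  have "\<not> seen n {} id" by (auto simp: seen_def intro: exI[of _ 0])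
  from sum_patterns_eq_if_not_seen[OF this, of "\<lambda>_. 1 :: nat"] show ?thesis by simp
qed

section \<open>Complete triangles in odd patterns\<close>

lemma full_count_even:
  assumes "f \<in> patterns n True"
  shows "full_count n f = 0"
proof -
  have "f i \<noteq> {..<3}" if "i < n" for i
  proof
    assume "f i = {..<3}"
    moreover have "even (card (f i))" using assms that by (auto simp: patterns_def PiE_iff)
    ultimately show False by simp
  qed
  then have "{i. i < n \<and> f i = {..<3}} = {}" by blast
  then show ?thesis by (simp add: full_count_def)
qed

text \<open>Exactly one of the four odd sets of sides is complete, and the choices in the other
  triangles are free.\<close>

lemma card_odd_patterns_full_at:
  assumes "i < n"
  shows "4 * card {f \<in> patterns n False. f i = {..<3}} = card (patterns n False)"
proof -
  let ?B = "{A. A \<subseteq> {..<3::nat} \<and> (even (card A) \<longleftrightarrow> False)}"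
  have "?B = {A \<in> Pow {0, 1, 2}. odd (card A)}" unfolding lessThan_3 by auto
  also have "\<dots> = {{0}, {1}, {2}, {0, 1, 2}}"
    by (auto simp: Pow_insert)
  finally have B: "card ?B = 4" by (simp add: doubleton_eq_iff)
  have "{f \<in> patterns n False. f i = {..<3}} = (\<Pi>\<^sub>E j\<in>{..<n}. if j = i then {{..<3}} else ?B)"
  proof (intro equalityI subsetI)
    fix f assume "f \<in> (\<Pi>\<^sub>E j\<in>{..<n}. if j = i then {{..<3}} else ?B)"
    then have f: "f \<in> extensional {..<n}" "\<And>j. j < n \<Longrightarrow> f j \<in> (if j = i then {{..<3}} else ?B)"
      by (simp_all only: PiE_iff) blast
    have "f j \<in> ?B" if "j < n" for j using f(2)[OF that] by (cases "j = i") auto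
    moreover have "f i = {..<3}" using f(2)[OF assms] by simp
    ultimately show "f \<in> {f \<in> patterns n False. f i = {..<3}}"
      using f(1) by (simp add: patterns_def PiE_iff)
  qed (auto simp: patterns_def PiE_iff)
  then have "card {f \<in> patterns n False. f i = {..<3}} =
      (\<Prod>j<n. card (if j = i then {{..<3}} else ?B))"
    by (simp add: card_PiE)
  also have "\<dots> = (\<Prod>j\<in>{..<n} - {i}. 4)"
    using assms B by (subst prod.remove[of _ i]) (auto intro!: prod.cong)
  finally have "4 * card {f \<in> patterns n False. f i = {..<3}} = 4 ^ n"
    using assms by (simp flip: power_Suc)
  then show ?thesis using B by (simp add: patterns_def card_PiE)
qed

text \<open>Linearity of expectation: sum over the triangles, each of which is complete in a quarter
  of the odd patterns.\<close>

lemma sum_full_count: "4 * (\<Sum>f\<in>patterns n False. full_count n f) = n * card (patterns n False)"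
proof -
  have "full_count n f = (\<Sum>i<n. of_bool (f i = {..<3}))" for f
    by (simp add: full_count_def of_bool_def sum.If_cases Int_def lessThan_def)
  then have "(\<Sum>f\<in>patterns n False. full_count n f) =
      (\<Sum>i<n. \<Sum>f\<in>patterns n False. of_bool (f i = {..<3}))"
    by (simp only:) (rule sum.swap)
  also have "\<dots> = (\<Sum>i<n. card {f \<in> patterns n False. f i = {..<3}})"
    using finite_patterns by (simp add: of_bool_def sum.If_cases Int_def)
  finally show ?thesis by (simp add: sum_distrib_left card_odd_patterns_full_at)
qed

text \<open>A reverse Markov bound. Counts never exceed \<open>n\<close> and average
  \<open>n/4\<close>; those in the set are at most \<open>n/50\<close>, so its fraction
  \<open>x\<close> satisfies \<open>1/4 \<le> 1 - 49/50 * x\<close>, giving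
  \<open>x \<le> 75/98 < 77/100\<close>.\<close>

lemma card_few_full_le:
  assumes "n > 0" "\<epsilon> \<le> 1 / 100"
  shows "real (card {f \<in> patterns n False. real (full_count n f) \<le> 2 * \<epsilon> * real n}) \<le>
         77 / 100 * real (card (patterns n False))"
proof -
  let ?O = "patterns n False"
  let ?B = "{f \<in> ?O. real (full_count n f) \<le> 2 * \<epsilon> * real n}"
  have le: "full_count n f \<le> n" for f
    unfolding full_count_def using card_mono[of "{..<n}" "{i. i < n \<and> f i = {..<3}}"] by auto
  have "real n * real (card ?O) / 4 = (\<Sum>f\<in>?O. real (full_count n f))"
    using arg_cong[OF sum_full_count[of n], of real] by simp
  also have "\<dots> \<le> (\<Sum>f\<in>?O. real n - of_bool (f \<in> ?B) * (49 / 50 * real n))"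
  proof (rule sum_mono)
    fix f
    have "2 * \<epsilon> * real n \<le> real n / 50" using assms by (simp add: mult_right_mono)
    then show "real (full_count n f) \<le> real n - of_bool (f \<in> ?B) * (49 / 50 * real n)"
      using le[of f] by auto
  qed
  also have "\<dots> = real n * real (card ?O) - real (card ?B) * (49 / 50 * real n)"
    unfolding sum_subtractf sum_distrib_right[symmetric] using finite_patterns[of n False]
    by (simp add: of_bool_def sum.If_cases Int_def)
  finally have "real n * (49 / 50 * card ?B) \<le> real n * (3 / 4 * card ?O)" by (simp add: algebra_simps)
  then have "49 / 50 * real (card ?B) \<le> 3 / 4 * card ?O" using assms(1) by simp
  then show ?thesis by simp
qed

section \<open>Random relabellings against a fixed query set\<close>

lemma arcs_subset: "S \<subseteq> vpairs V \<Longrightarrow> arcs S \<subseteq> V \<times> V"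
  by (auto simp: arcs_def vpairs_def)

text \<open>Each arc prescribes the images of \<open>u\<close> and \<open>v\<close>, and different
  arcs give disjoint sets of permutations.\<close>

lemma card_permutes_pair_in:
  assumes V: "finite V" and uv: "u \<in> V" "v \<in> V" "u \<noteq> v" and S: "S \<subseteq> vpairs V"
  shows "card {p. p permutes V \<and> p ` {u, v} \<in> S} = card (arcs S) * fact (card V - 2)"
proof -
  let ?F = "\<lambda>a. {p. p permutes V \<and> map p [u, v] = [fst a, snd a]}"
  have fin: "finite (arcs S)" using arcs_subset[OF S] V by (auto intro: finite_subset)
  have "{p. p permutes V \<and> p ` {u, v} \<in> S} = (\<Union>a\<in>arcs S. ?F a)"
    using uv by (auto simp: arcs_def permutes_inj inj_eq)
  also have "card \<dots> = (\<Sum>a\<in>arcs S. card (?F a))"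
    using fin V by (intro card_UN_disjoint)
      (auto simp: prod_eq_iff intro: finite_subset[OF _ finite_permutations[OF V]])
  also have "\<dots> = (\<Sum>a\<in>arcs S. fact (card V - length [u, v]))"
  proof (rule sum.cong[OF refl])
    fix a assume a: "a \<in> arcs S"
    then show "card (?F a) = fact (card V - length [u, v])"
      using uv subsetD[OF arcs_subset[OF S] a]
      by (intro card_permutes_map_eq[OF V]) (auto simp: arcs_def)
  qed
  finally show ?thesis by (simp add: numeral_2_eq_2)
qed

text \<open>Double counting of relabellings and sides: all \<open>3 * n\<close> sides fall into
  \<open>S\<close> equally often. This ties the sample cost at a randomly relabelled
  \<open>disjoint_triangles n\<close> to the number of arcs.\<close>

lemma sum_card_edges_inter:
  assumes S: "S \<subseteq> vpairs ({..<n} \<times> {..<3})"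
  shows "(\<Sum>p | p permutes ({..<n} \<times> {..<3}). card (pattern_edges n p (\<lambda>_. {..<3}) \<inter> S)) =
         3 * n * (card (arcs S) * fact (3 * n - 2))"
proof -
  let ?V = "{..<n} \<times> {..<3::nat}"
  let ?P = "{p. p permutes ?V}"
  have finP: "finite ?P" by (rule finite_permutations) simp
  have "card (pattern_edges n p (\<lambda>_. {..<3}) \<inter> S) =
        (\<Sum>(i, k)\<in>?V. of_bool (p ` tri_pair i k \<in> S))" if p: "p permutes ?V" for p
  proof -
    have "pattern_edges n p (\<lambda>_. {..<3}) \<inter> S =
        (\<lambda>(i, k). p ` tri_pair i k) ` {(i, k). i < n \<and> k < 3 \<and> p ` tri_pair i k \<in> S}"
      by (auto simp: pattern_edges_def)
    moreover have "inj_on (\<lambda>(i, k). p ` tri_pair i k) {(i, k). i < n \<and> k < 3 \<and> p ` tri_pair i k \<in> S}"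
      using permutes_inj[OF p] by (auto simp: inj_on_def inj_image_eq_iff tri_pair_eq_iff)
    ultimately have "card (pattern_edges n p (\<lambda>_. {..<3}) \<inter> S) =
        card {a \<in> ?V. p ` tri_pair (fst a) (snd a) \<in> S}"
      by (simp add: card_image) (auto intro!: arg_cong[where f = card])
    then show ?thesis
      by (simp add: case_prod_beta of_bool_def sum.If_cases Int_def)
  qed
  then have "(\<Sum>p\<in>?P. card (pattern_edges n p (\<lambda>_. {..<3}) \<inter> S)) =
      (\<Sum>p\<in>?P. \<Sum>(i, k)\<in>?V. of_bool (p ` tri_pair i k \<in> S))" by simp
  also have "\<dots> = (\<Sum>(i, k)\<in>?V. card {p. p permutes ?V \<and> p ` tri_pair i k \<in> S})"
    using finP by (subst sum.swap) (auto simp: of_bool_def sum.If_cases Int_def intro!: sum.cong)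
  also have "\<dots> = (\<Sum>(i, k)\<in>?V. card (arcs S) * fact (3 * n - 2))"
  proof (rule sum.cong[OF refl], clarify)
    fix i k assume "i < n" "k < (3::nat)"
    then have "tri_pair i k \<in> vpairs ?V" by (rule tri_pair_in_vpairs)
    then obtain u v where "tri_pair i k = {u, v}" "u \<in> ?V" "v \<in> ?V" "u \<noteq> v"
      by (auto simp: vpairs_def card_2_iff)
    then show "card {p. p permutes ?V \<and> p ` tri_pair i k \<in> S} = card (arcs S) * fact (3 * n - 2)"
      using card_permutes_pair_in[of ?V u v S] S by (simp add: card_cartesian_product mult.commute)
  qed
  also have "\<dots> = 3 * n * (card (arcs S) * fact (3 * n - 2))"
    by (simp add: case_prod_unfold card_cartesian_product)
  finally show ?thesis .
qed

text \<open>Union bound over the index \<open>i\<close> and the ordered triangle onto which its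
  corners are mapped; three images are then prescribed.\<close>

lemma card_seen_le:
  assumes S: "S \<subseteq> vpairs ({..<n} \<times> {..<3})"
  shows "card {p. p permutes ({..<n} \<times> {..<3}) \<and> seen n S p} \<le>
         n * (card (ordered_triangles (arcs S)) * fact (3 * n - 3))"
proof -
  let ?V = "{..<n} \<times> {..<3::nat}"
  let ?T = "ordered_triangles (arcs S)"
  let ?F = "\<lambda>i (x, y, z). {p. p permutes ?V \<and> map p [(i, 0), (i, 1), (i, 2)] = [x, y, z]}"
  have TV: "?T \<subseteq> ?V \<times> ?V \<times> ?V" using arcs_subset[OF S] by (auto simp: ordered_triangles_def)
  have finT: "finite ?T" by (rule finite_subset[OF TV]) simp
  have finF: "finite (?F i t)" for i t
    by (cases t) (auto intro: finite_subset[OF _ finite_permutations[of ?V]])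
  have "{p. p permutes ?V \<and> seen n S p} \<subseteq> (\<Union>i<n. \<Union>t\<in>?T. ?F i t)"
  proof clarify
    fix p assume p: "p permutes ?V" "seen n S p"
    then obtain i where i: "i < n" "\<And>k. k < 3 \<Longrightarrow> p ` tri_pair i k \<in> S" by (auto simp: seen_def)
    have "tri_pair i 0 = {(i, 1), (i, 2)}" "tri_pair i 1 = {(i, 0), (i, 2)}"
      "tri_pair i 2 = {(i, 0), (i, 1)}"
      unfolding tri_pair_def lessThan_3 by auto
    then have "(p (i, 0), p (i, 1), p (i, 2)) \<in> ?T"
      using i(2)[of 0] i(2)[of 1] i(2)[of 2] permutes_inj[OF p(1)]
      by (simp add: ordered_triangles_def arcs_def inj_eq)
    then show "p \<in> (\<Union>i<n. \<Union>t\<in>?T. ?F i t)" using p(1) i(1) by force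
  qed
  then have "card {p. p permutes ?V \<and> seen n S p} \<le> card (\<Union>i<n. \<Union>t\<in>?T. ?F i t)"
    using finT finF by (intro card_mono) auto
  also have "\<dots> \<le> (\<Sum>i<n. card (\<Union>t\<in>?T. ?F i t))" by (rule card_UN_le) simp
  also have "\<dots> \<le> (\<Sum>i<n. \<Sum>t\<in>?T. card (?F i t))" by (intro sum_mono card_UN_le finT)
  also have "\<dots> = (\<Sum>i<n. \<Sum>t\<in>?T. fact (3 * n - 3))"
  proof (intro sum.cong refl)
    fix i t assume i: "i \<in> {..<n}" and t: "t \<in> ?T"
    obtain x y z where xyz: "t = (x, y, z)" by (cases t)
    have "card {p. p permutes ?V \<and> map p [(i, 0), (i, 1), (i, 2)] = [x, y, z]} =
        fact (card ?V - length [(i, 0::nat), (i, 1), (i, 2)])"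
      using i t TV unfolding xyz
      by (intro card_permutes_map_eq) (auto simp: ordered_triangles_def arcs_def)
    then show "card (?F i t) = fact (3 * n - 3)"
      by (simp add: xyz card_cartesian_product mult.commute numeral_3_eq_3)
  qed
  finally show ?thesis by simp
qed

text \<open>With \<open>q\<close> the fraction of relabellings that are seen and \<open>r\<close>
  the number of arcs, the chain \<open>q^3 * n^4 \<le> q^2 * n^4 \<le> T^2 \<le> r^3\<close> and a
  cube root give the bound.\<close>

lemma card_seen_le_card_arcs:
  assumes n: "n > 0" and S: "S \<subseteq> vpairs ({..<n} \<times> {..<3})"
  shows "real (card {p. p permutes ({..<n} \<times> {..<3}) \<and> seen n S p}) * real n powr (4/3) \<le>
         real (card (arcs S)) * fact (3 * n)"
proof -
  let ?V = "{..<n} \<times> {..<3::nat}"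
  define K where "K = card {p. p permutes ?V \<and> seen n S p}"
  define T where "T = card (ordered_triangles (arcs S))"
  define q where "q = real K / fact (3 * n)"
  have "K \<le> card {p. p permutes ?V}"
    unfolding K_def by (intro card_mono finite_permutations) auto
  also have "\<dots> = fact (3 * n)"
    by (rule card_permutations) (auto simp: card_cartesian_product)
  finally have "real K \<le> real (fact (3 * n))" by (simp only: of_nat_le_iff)
  then have q1: "q \<le> 1" "0 \<le> q" by (simp_all add: q_def)
  obtain m where "3 * n = Suc (Suc (Suc m))"
    using n by (metis Suc_pred add_Suc_right mult_Suc_right numeral_3_eq_3 plus_nat.simps)
  then have "(fact (3 * n) :: nat) = (3 * n) * ((3 * n - 1) * ((3 * n - 2) * fact (3 * n - 3)))"
    by (simp add: numeral_3_eq_3 numeral_2_eq_2)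
  \<comment> \<open>As \<open>n > 0\<close>, each of the three leading factors of
    \<open>fact (3 * n)\<close> is at least \<open>n\<close>. Combined with the union bound this
    yields \<open>q * n^2 \<le> T\<close>.\<close>
  moreover have "n * (n * (n * fact (3 * n - 3))) \<le>
      (3 * n) * ((3 * n - 1) * ((3 * n - 2) * fact (3 * n - 3)))"
    using n by (intro mult_le_mono) auto
  ultimately have "T * (n * (n * (n * fact (3 * n - 3)))) \<le> T * fact (3 * n)" by simp
  moreover have "K * n\<^sup>2 \<le> n * (T * fact (3 * n - 3)) * n\<^sup>2"
    unfolding K_def T_def by (intro mult_le_mono card_seen_le[OF S] order_refl)
  moreover have "n * (T * fact (3 * n - 3)) * n\<^sup>2 = T * (n * (n * (n * fact (3 * n - 3))))"
    by (simp add: power2_eq_square)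
  ultimately have "K * n\<^sup>2 \<le> T * fact (3 * n)" by linarith
  then have "real (K * n\<^sup>2) \<le> real (T * fact (3 * n))" by (simp only: of_nat_le_iff)
  then have qT: "q * (real n)\<^sup>2 \<le> real T" by (simp add: q_def field_simps)
  have "finite (arcs S)" using arcs_subset[OF S] by (auto intro: finite_subset)
  then have "T\<^sup>2 \<le> card (arcs S) ^ 3"
    unfolding T_def by (rule card_ordered_triangles_squared_le)
  then have T2: "(real T)\<^sup>2 \<le> real (card (arcs S)) ^ 3" by (metis of_nat_le_iff of_nat_power)
  have "(real n powr (4/3)) ^ 3 = real n ^ 4"
    using n by (simp add: powr_power)
  then have "(q * real n powr (4/3)) ^ 3 = q ^ 3 * real n ^ 4" by (simp add: power_mult_distrib)
  \<comment> \<open>Since \<open>q \<le> 1\<close>, one factor \<open>q\<close> can be given up,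
    which leaves a perfect square.\<close>
  also have "\<dots> \<le> q ^ 2 * real n ^ 4"
    using q1 by (intro mult_right_mono power_decreasing) auto
  also have "\<dots> = (q * (real n)\<^sup>2)\<^sup>2" by (simp add: power_mult_distrib)
  also have "\<dots> \<le> (real T)\<^sup>2" using qT q1 by (intro power_mono) auto
  also note T2
  finally have "q * real n powr (4/3) \<le> real (card (arcs S))"
    using q1 by (subst (asm) power_mono_iff) auto
  then show ?thesis by (simp add: q_def K_def field_simps)
qed

section \<open>Distinguishing the two parities costs samples\<close>

lemma sample_lower_bound:
  assumes n: "n > 0" and eps: "0 < \<epsilon>" "\<epsilon> \<le> 1 / 100"
    and alg: "sampling_algorithm (verts (disjoint_triangles n)) D est"
    and sol: "solves D est (disjoint_triangles n) s \<epsilon> (1/10)"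
  shows "real n powr (1/3) / 100 \<le> s"
proof -
  define V where "V = {..<n} \<times> {..<3::nat}"
  define P where "P = {p. p permutes V}"
  define M where "M = real (card (patterns n False))"
  define N where "N = (fact (3 * n) :: real)"
  define E where "E g = measure_pmf.expectation D g" for g :: "(nat \<times> nat) set set \<Rightarrow> real"
  \<comment> \<open>\<open>h\<close> is the probability of an answer acceptable for a triangle-free
    input.\<close>
  define h where "h S X = measure (est S X) {- \<epsilon> * real n..\<epsilon> * real n}" for S X
  define obs where "obs p f S = pattern_edges n p f \<inter> S" for p f S
  \<comment> \<open>For odd patterns outside \<open>bad\<close>, the interval of acceptable answers
    is disjoint from the one around 0.\<close>
  define bad where "bad = {f \<in> patterns n False. real (full_count n f) \<le> 2 * \<epsilon> * real n}"
  define L where "L S = (\<Sum>p\<in>P. \<Sum>f\<in>patterns n True. h S (obs p f S))" for S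
  define R where "R S = (\<Sum>p\<in>P. \<Sum>f\<in>patterns n False. h S (obs p f S))" for S
  define K where "K S = real (card {p\<in>P. seen n S p})" for S

  have D: "S \<subseteq> vpairs V" if "S \<in> set_pmf D" for S
    using alg that by (auto simp: sampling_algorithm_def disjoint_triangles_def V_def)
  have ps: "prob_space (est S X)" and sets: "sets (est S X) = sets borel" for S X
    using alg by (auto simp: sampling_algorithm_def space_prob_algebra)
  have "finite (vpairs V)"
    by (auto simp: V_def vpairs_def intro: finite_subset[of _ "Pow ({..<n} \<times> {..<3})"])
  \<comment> \<open>Finite support makes every real function of \<open>S\<close> integrable, so
    \<open>E\<close> is linear and monotone without further conditions.\<close>
  then have "finite (set_pmf D)" using D by (meson Pow_iff finite_Pow_iff finite_subset subsetI)
  then have int: "integrable (measure_pmf D) g" for g :: "(nat \<times> nat) set set \<Rightarrow> real"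
    by (rule integrable_measure_pmf_finite)
  have E_mono: "E g \<le> E g'" if "\<And>S. S \<in> set_pmf D \<Longrightarrow> g S \<le> g' S" for g g'
    unfolding E_def using that by (intro integral_mono_AE int) (simp add: AE_measure_pmf_iff)
  have E_sum: "E (\<lambda>S. \<Sum>i\<in>I. g i S) = (\<Sum>i\<in>I. E (g i))" for I :: "'i set" and g
    unfolding E_def by (rule Bochner_Integration.integral_sum) (rule int)
  have E_add: "E (\<lambda>S. g S + g' S) = E g + E g'" for g g'
    unfolding E_def by (rule Bochner_Integration.integral_add) (rule int)+
  have E_cmult: "E (\<lambda>S. c * g S) = c * E g" for c g
    unfolding E_def by simp
  have E_const: "E (\<lambda>S. c) = c" for c unfolding E_def by simp

  have finP: "finite P" unfolding P_def V_def by (rule finite_permutations) simp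
  have cardP: "real (card P) = N"
    unfolding P_def V_def N_def by (subst card_permutations) (auto simp: card_cartesian_product)
  have N: "N > 0" by (simp add: N_def)
  have h01: "0 \<le> h S X" "h S X \<le> 1" for S X
    using prob_space.prob_le_1[OF ps] by (simp_all add: h_def)

  have correct: "9/10 \<le> E (\<lambda>S. measure (est S (obs p f S))
        {real (full_count n f) - \<epsilon> * real n..real (full_count n f) + \<epsilon> * real n})"
    if "p \<in> P" "\<And>i. i < n \<Longrightarrow> f i \<subseteq> {..<3}" for p f
    using sol pattern_in_inputs[of p n f] triangles_pattern[of p n f] that
    by (fastforce simp: solves_def return_prob_def P_def V_def E_def obs_def triangles_disjoint_triangles)
  \<comment> \<open>The query distribution ignores the input, so its cost may be tested at
    relabelled copies of \<open>disjoint_triangles n\<close>, although the inputs compared are the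
    parity patterns.\<close>
  have cost: "E (\<lambda>S. real (card (obs p (\<lambda>_. {..<3}) S))) \<le> s" if "p \<in> P" for p
    using sol pattern_in_inputs[of p n "\<lambda>_. {..<3}"] that
    by (fastforce simp: solves_def sample_cost_def P_def V_def E_def obs_def)

  have even: "9/10 \<le> E (\<lambda>S. h S (obs p f S))" if "p \<in> P" "f \<in> patterns n True" for p f
    using correct[OF that(1), of f] patterns_subset[OF that(2)] full_count_even[OF that(2)]
    by (simp add: h_def)
  have odd: "E (\<lambda>S. h S (obs p f S)) \<le> 1/10 + of_bool (f \<in> bad)"
    if "p \<in> P" "f \<in> patterns n False" for p f
  proof (cases "f \<in> bad")
    case True
    have "E (\<lambda>S. h S (obs p f S)) \<le> E (\<lambda>S. 1)" by (intro E_mono h01)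
    then show ?thesis using True by (simp add: E_const)
  next
    case False
    then have far: "2 * \<epsilon> * real n < real (full_count n f)" using that by (simp add: bad_def)
    define J where "J = {real (full_count n f) - \<epsilon> * real n..real (full_count n f) + \<epsilon> * real n}"
    have "h S X + measure (est S X) J \<le> 1" for S X
    proof -
      interpret prob_space "est S X" by (rule ps)
      have "{- \<epsilon> * real n..\<epsilon> * real n} \<inter> J = {}" using far by (auto simp: J_def)
      then have "h S X + measure (est S X) J = prob ({- \<epsilon> * real n..\<epsilon> * real n} \<union> J)"
        unfolding h_def by (intro finite_measure_Union[symmetric]) (auto simp: sets J_def)
      then show ?thesis by simp
    qed
    then have "E (\<lambda>S. h S (obs p f S) + measure (est S (obs p f S)) J) \<le> E (\<lambda>S. 1)"
      by (intro E_mono)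
    then show ?thesis
      using correct[OF that(1), of f] patterns_subset[OF that(2)] False
      by (simp add: E_add E_const J_def)
  qed

  have bad: "real (card bad) \<le> 77/100 * M"
    unfolding bad_def M_def by (rule card_few_full_le[OF n eps(2)])
  have "N * (9/10 * M) = (\<Sum>p\<in>P. \<Sum>f\<in>patterns n True. 9/10)"
    by (simp add: cardP M_def card_patterns_eq)
  also have "\<dots> \<le> E L"
    unfolding L_def E_sum by (intro sum_mono even)
  finally have EL: "N * (9/10 * M) \<le> E L" .
  have "E R \<le> (\<Sum>p\<in>P. \<Sum>f\<in>patterns n False. 1/10 + of_bool (f \<in> bad))"
    unfolding R_def E_sum by (intro sum_mono odd)
  also have "\<dots> = N * (1/10 * M + card bad)"
  proof -
    have "patterns n False \<inter> bad = bad" by (auto simp: bad_def)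
    then have "(\<Sum>f\<in>patterns n False. of_bool (f \<in> bad)) = real (card bad)"
      using finite_patterns[of n False] by (simp add: of_bool_def sum.If_cases)
    then show ?thesis by (simp add: cardP M_def sum.distrib)
  qed
  \<comment> \<open>\<open>1/10 + 77/100 = 87/100\<close>, which stays below \<open>9/10\<close> by
    a gap of \<open>3/100\<close>.\<close>
  also have "\<dots> \<le> N * (87/100 * M)" using bad N by simp
  finally have ER: "E R \<le> N * (87/100 * M)" .

  \<comment> \<open>Relabellings that are not seen contribute equally to \<open>L S\<close> and
    \<open>R S\<close>; each seen one costs at most \<open>M\<close>, because \<open>h\<close> lies
    between 0 and 1.\<close>
  have "L S \<le> R S + M * K S" for S
  proof -
    have "(\<Sum>f\<in>patterns n True. h S (obs p f S)) \<le>
        (\<Sum>f\<in>patterns n False. h S (obs p f S)) + M * of_bool (seen n S p)" for p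
    proof (cases "seen n S p")
      case True
      have "(\<Sum>f\<in>patterns n True. h S (obs p f S)) \<le> (\<Sum>f\<in>patterns n True. 1)"
        by (intro sum_mono h01)
      also have "\<dots> = M" by (simp add: M_def card_patterns_eq)
      finally show ?thesis
        using True sum_nonneg[of "patterns n False" "\<lambda>f. h S (obs p f S)"] h01 by simp
    next
      case False
      then show ?thesis
        unfolding obs_def using sum_patterns_eq_if_not_seen[OF False, of "h S"] by simp
    qed
    then have "L S \<le> (\<Sum>p\<in>P. (\<Sum>f\<in>patterns n False. h S (obs p f S)) + M * of_bool (seen n S p))"
      unfolding L_def by (intro sum_mono)
    also have "\<dots> = R S + M * K S"
      using finP by (simp add: R_def K_def sum.distrib of_bool_def sum.If_cases Int_def
        flip: sum_distrib_left)
    finally show ?thesis .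
  qed
  then have "E L \<le> E (\<lambda>S. R S + M * K S)" by (intro E_mono)
  then have "N * (9/10 * M) \<le> N * (87/100 * M) + M * E K"
    using EL ER unfolding E_add E_cmult by linarith
  then have "M * (3/100 * N) \<le> M * E K" by (simp add: algebra_simps)
  moreover have "M > 0"
  proof -
    \<comment> \<open>Keeping exactly one side of every triangle is an odd pattern, so
      \<open>M\<close> can be cancelled.\<close>
    have "(\<lambda>i\<in>{..<n}. {0}) \<in> patterns n False" by (simp add: patterns_def)
    then show ?thesis using finite_patterns by (auto simp: M_def card_gt_0_iff)
  qed
  ultimately have EK: "3/100 * N \<le> E K" by simp

  define a where "a S = real (card (arcs S))" for S :: "(nat \<times> nat) set set"
  have "real n powr (4/3) * K S \<le> N * a S" if "S \<in> set_pmf D" for S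
    using card_seen_le_card_arcs[OF n, of S] D[OF that]
    by (simp add: K_def P_def V_def N_def a_def mult.commute)
  then have "E (\<lambda>S. real n powr (4/3) * K S) \<le> E (\<lambda>S. N * a S)" by (rule E_mono)
  then have "real n powr (4/3) * E K \<le> N * E a" by (simp add: E_cmult)
  moreover have "real n powr (4/3) * (3/100 * N) \<le> real n powr (4/3) * E K"
    using EK by (intro mult_left_mono) auto
  ultimately have "N * (3/100 * real n powr (4/3)) \<le> N * E a" by (simp add: mult_ac)
  then have Ea: "3/100 * real n powr (4/3) \<le> E a" using N by simp

  \<comment> \<open>Exposes the factor shared with the total cost over all relabellings; the
    quotient is \<open>3 * n - 1\<close>.\<close>
  have fact_eq: "N = 3 * n * ((3 * n - 1) * fact (3 * n - 2))"
  proof -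
    obtain m where "3 * n = Suc (Suc m)"
      using n by (metis Suc_pred add_Suc_right mult_Suc_right numeral_3_eq_3 plus_nat.simps)
    then have "fact (3 * n) = (3 * n * ((3 * n - 1) * fact (3 * n - 2)) :: nat)"
      by (simp add: numeral_2_eq_2)
    then show ?thesis unfolding N_def by (metis of_nat_fact)
  qed
  have "E (\<lambda>S. (3 * n * fact (3 * n - 2)) * a S) \<le> E (\<lambda>S. \<Sum>p\<in>P. real (card (obs p (\<lambda>_. {..<3}) S)))"
  proof (rule E_mono)
    fix S assume "S \<in> set_pmf D"
    from sum_card_edges_inter[OF D[OF this, unfolded V_def]]
    have "real (\<Sum>p\<in>P. card (obs p (\<lambda>_. {..<3}) S)) = real (3 * n * (card (arcs S) * fact (3 * n - 2)))"
      by (simp only: P_def V_def obs_def)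
    then show "(3 * n * fact (3 * n - 2)) * a S \<le> (\<Sum>p\<in>P. real (card (obs p (\<lambda>_. {..<3}) S)))"
      by (simp add: a_def mult_ac)
  qed
  also have "\<dots> \<le> (\<Sum>p\<in>P. s)" unfolding E_sum by (intro sum_mono cost)
  also have "\<dots> = (3 * n * fact (3 * n - 2)) * ((3 * n - 1) * s)"
    unfolding sum_constant cardP fact_eq using n by (simp add: of_nat_diff)
  finally have Eas: "E a \<le> (3 * real n - 1) * s" using n by (simp add: E_cmult)
  \<comment> \<open>Nonnegativity of \<open>E a\<close> forces \<open>0 \<le> s\<close>, which
    allows \<open>3 * n - 1\<close> to be enlarged to \<open>3 * n\<close>.\<close>
  moreover have "0 \<le> E a" unfolding E_def a_def by simp
  ultimately have "0 \<le> (3 * real n - 1) * s" by linarith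
  then have "0 \<le> s" using n by (simp add: zero_le_mult_iff)
  then have "E a \<le> 3 * n * s" using Eas by (simp add: left_diff_distrib)
  then have "3/100 * real n powr (4/3) \<le> 3 * n * s" using Ea by linarith
  \<comment> \<open>Dividing by \<open>3 * n\<close> lowers the exponent to \<open>1/3\<close> and
    turns \<open>3/100\<close> into \<open>1/100\<close>.\<close>
  moreover have "real n powr (4/3) = n * real n powr (1/3)"
    using n powr_add[of "real n" 1 "1/3"] by simp
  ultimately show ?thesis using n by simp
qed

theorem mainTheorem7:
  "\<exists>\<epsilon>\<^sub>0 > 0. \<forall>\<epsilon>. 0 < \<epsilon> \<and> \<epsilon> \<le> \<epsilon>\<^sub>0 \<longrightarrow>
     (\<lambda>n. instopt (disjoint_triangles n) \<epsilon> (1/10)) \<in> \<Omega>(\<lambda>n. real n powr (1/3))"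
proof (intro exI[of _ "1/100"] conjI allI impI)
  \<comment> \<open>The threshold \<open>1/100\<close> is the one under which
    \<open>card_few_full_le\<close> applies.\<close>
  fix \<epsilon> :: real assume eps: "0 < \<epsilon> \<and> \<epsilon> \<le> 1/100"
  \<comment> \<open>Every feasible \<open>s\<close> obeys the bound, and nonemptiness of the
    feasible set carries it over to the infimum.\<close>
  have bound: "real n powr (1/3) / 100 \<le> instopt (disjoint_triangles n) \<epsilon> (1/10)" if "n > 0" for n
    unfolding instopt_def
    by (rule cInf_greatest)
      (use instopt_set_nonempty[OF is_graph_disjoint_triangles] sample_lower_bound[OF that] eps in auto)
  show "(\<lambda>n. instopt (disjoint_triangles n) \<epsilon> (1/10)) \<in> \<Omega>(\<lambda>n. real n powr (1/3))"
  proof (rule landau_omega.bigI[where c = "1/100"])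
    show "\<forall>\<^sub>F n in sequentially. norm (instopt (disjoint_triangles n) \<epsilon> (1/10)) \<ge>
        1/100 * norm (real n powr (1/3))"
      using eventually_gt_at_top[of 0]
    proof eventually_elim
      case (elim n)
      from bound[OF elim] show ?case by simp
    qed
  qed simp
qed simp

end
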